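(* Let $\alpha,\beta>0$ and $\lambda,\mu>0$ be real numbers such that $\alpha<\beta$, $\mu\ge 1+\lambda$ and $\lambda\beta-\alpha\mu<0$. Then for every positive integer $n$, $$\sin x+\sum_{k=2}^n\frac{(k+\alpha)^{\lambda}}{(k+\beta)^{\mu}}\sin kx>0,\qquad x\in(0,\pi).$$
   Context: For $n=1$ the sum over $k$ is empty. *)

theory Defs
  imports Complex_Main
begin

end

theory Submission
  imports Defs
begin

text \<open>
  Write \<open>a\<^sub>k = (k + \<alpha>) powr l / (k + \<beta>) powr \<mu>\<close> for \<open>k \<ge> 2\<close>. Three features of these weights
  are used: they decrease, the numbers \<open>b\<^sub>k = k a\<^sub>k\<close> lie in \<open>(0, 1)\<close>, and \<open>b\<^sub>k\<close> is unimodal, that is,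
  once it has decreased it never increases again. The interval \<open>(0, \<pi>)\<close> is cut at distance
  \<open>1/2\<close> from \<open>\<pi>\<close>, and each part uses summation by parts in a different way.

  Away from \<open>\<pi>\<close>, the decreasing weights \<open>a\<^sub>k\<close> are summed by parts against \<open>sin (k x)\<close>. After
  multiplication by \<open>2 sin (x/2)\<close> the whole tail \<open>k \<ge> 2\<close> contributes at least
  \<open>- a\<^sub>2 (1 - cos (3x/2))\<close>. Since \<open>a\<^sub>2 < 1/2\<close>, the first term wins as soon as the cubic
  inequality \<open>(1 - c) (4 c\<^sup>2 + 4 c - 1) > 0\<close> holds for \<open>c = cos (x/2)\<close>, and this is true if
  \<open>c\<close> exceeds \<open>(sqrt 2 - 1) / 2\<close>, about \<open>0.207\<close>.

  Near \<open>\<pi>\<close>, put \<open>y = \<pi> - x\<close>. The sum becomes \<open>sin y + \<Sum> b\<^sub>k s\<^sub>k\<close> with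
  \<open>s\<^sub>k = (-1)^(k+1) sin (k y) / k\<close>. All partial sums of \<open>s\<^sub>1 + s\<^sub>2 + \<dots>\<close> stay between \<open>0\<close> and their
  first term \<open>sin y\<close> when \<open>y \<le> 1/2\<close> (lemma \<open>alt_sine_sum_bounds\<close>). Summation by parts against a
  unimodal \<open>b\<close> then loses at most \<open>max b \<sqdot> sin y\<close> (lemma \<open>unimodal_weighted_sum_bound\<close>), which is
  less than \<open>sin y\<close> because \<open>b\<^sub>k < 1\<close>.
\<close>

section \<open>Decreasing weights away from the endpoint\<close>

text \<open>
  Summation by parts against \<open>2 sin (x/2) sin (k x) = cos ((k - 1/2) x) - cos ((k + 1/2) x)\<close>, each
  intermediate cosine being estimated by \<open>1\<close>, which costs \<open>a 2 - a n\<close> in total. The boundary term at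
  \<open>n\<close> is kept exactly, because the step to \<open>n + 1\<close> merges it with the next difference of cosines.
\<close>

lemma decreasing_sine_sum_bound_aux:
  fixes a :: "nat \<Rightarrow> real" and x :: real
  assumes dec: "\<And>k. k \<ge> 2 \<Longrightarrow> a (Suc k) \<le> a k" and "n \<ge> 2"
  shows "a 2 * cos (3 * x / 2) - (a 2 - a n) - a n * cos ((real n + 1/2) * x)
         \<le> 2 * sin (x / 2) * (\<Sum>k = 2..n. a k * sin (real k * x))"
  using \<open>n \<ge> 2\<close>
proof (induction n rule: dec_induct)
  case base
  have "2 * sin (x/2) * sin (2 * x) = cos (3 * x / 2) - cos (5 * x / 2)"
    using sin_times_sin[of "2 * x" "x/2"] by (simp add: field_simps)
  from arg_cong[OF this, of "\<lambda>u. a 2 * u"] show ?case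
    by (simp add: algebra_simps)
next
  case (step n)
  have "2 * sin (x/2) * sin (real (Suc n) * x)
      = cos ((real n + 1/2) * x) - cos ((real (Suc n) + 1/2) * x)"
    using sin_times_sin[of "real (Suc n) * x" "x/2"] by (simp add: field_simps)
  from arg_cong[OF this, of "\<lambda>u. a (Suc n) * u"]
  have eq: "2 * sin (x/2) * (\<Sum>k = 2..Suc n. a k * sin (real k * x))
      = 2 * sin (x/2) * (\<Sum>k = 2..n. a k * sin (real k * x))
        + a (Suc n) * (cos ((real n + 1/2) * x) - cos ((real (Suc n) + 1/2) * x))"
    using step.hyps by (simp add: algebra_simps)
  have "(a n - a (Suc n)) * cos ((real n + 1/2) * x) \<le> (a n - a (Suc n)) * 1"
    using dec[of n] step.hyps by (intro mult_left_mono) auto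
  then show ?case
    unfolding eq using step.IH by (simp only: algebra_simps)
qed

lemma decreasing_sine_sum_bound:
  fixes a :: "nat \<Rightarrow> real" and x :: real
  assumes dec: "\<And>k. k \<ge> 2 \<Longrightarrow> a (Suc k) \<le> a k" and nonneg: "\<And>k. k \<ge> 2 \<Longrightarrow> 0 \<le> a k"
    and "n \<ge> 2"
  shows "- (a 2 * (1 - cos (3 * x / 2))) \<le> 2 * sin (x / 2) * (\<Sum>k = 2..n. a k * sin (real k * x))"
proof -
  have "a n * cos ((real n + 1/2) * x) \<le> a n * 1"
    using nonneg[OF \<open>n \<ge> 2\<close>] by (intro mult_left_mono) auto
  then show ?thesis
    using decreasing_sine_sum_bound_aux[of a n x, OF dec \<open>n \<ge> 2\<close>] by (simp add: algebra_simps)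
qed

text \<open>
  With \<open>c = cos (x/2)\<close>, the first term multiplied by \<open>2 sin (x/2)\<close> is \<open>c - cos (3x/2)\<close>, where
  \<open>cos (3x/2) = 4 c\<^sup>3 - 3 c\<close>. For \<open>a\<^sub>2 \<le> 1/2\<close> the claim reduces to
  \<open>5 c - 4 c\<^sup>3 - 1 = (1 - c) (4 c\<^sup>2 + 4 c - 1) > 0\<close>.
\<close>

lemma sine_sum_pos_away_from_pi:
  fixes a :: "nat \<Rightarrow> real" and x :: real
  assumes dec: "\<And>k. k \<ge> 2 \<Longrightarrow> a (Suc k) \<le> a k" and nonneg: "\<And>k. k \<ge> 2 \<Longrightarrow> 0 \<le> a k"
    and a2: "a 2 \<le> 1/2" and "n \<ge> 2"
    and x: "0 < x" "x < pi" and c: "cos (x / 2) \<ge> 21/100"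
  shows "0 < sin x + (\<Sum>k = 2..n. a k * sin (real k * x))"
proof -
  define c where "c = cos (x / 2)"
  have c_less: "c < 1"
    using cos_monotone_0_pi[of 0 "x/2"] x by (simp add: c_def)
  have cos3: "cos (3 * x / 2) = 4 * c ^ 3 - 3 * c"
    using cos_treble_cos[of "x/2"] by (simp add: c_def)
  have "2 * sin (x/2) * sin x = cos (x/2) - cos (3 * x / 2)"
    using sin_times_sin[of x "x/2"] by (simp add: field_simps)
  then have first: "2 * sin (x/2) * sin x = c - (4 * c ^ 3 - 3 * c)"
    by (simp add: c_def cos3)
  have "a 2 * (1 - cos (3 * x / 2)) \<le> 1/2 * (1 - cos (3 * x / 2))"
    using a2 by (intro mult_right_mono) auto
  then have tail: "- (1/2 * (1 - (4 * c ^ 3 - 3 * c)))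
      \<le> 2 * sin (x/2) * (\<Sum>k = 2..n. a k * sin (real k * x))"
    using decreasing_sine_sum_bound[of a n x, OF dec nonneg \<open>n \<ge> 2\<close>] unfolding cos3 by linarith
  have "(21/100)\<^sup>2 \<le> c\<^sup>2"
    using c by (intro power_mono) (auto simp: c_def)
  then have "4 * c\<^sup>2 + 4 * c - 1 > 0"
    using c by (simp add: c_def power2_eq_square)
  then have "0 < (1 - c) * (4 * c\<^sup>2 + 4 * c - 1)"
    using c_less by simp
  also have "\<dots> = 5 * c - 4 * c ^ 3 - 1"
    by (simp add: algebra_simps power2_eq_square power3_eq_cube)
  finally have "0 < 2 * sin (x/2) * sin x
      + 2 * sin (x/2) * (\<Sum>k = 2..n. a k * sin (real k * x))"
    using first tail by (simp add: algebra_simps)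
  then have "0 < 2 * sin (x/2) * (sin x + (\<Sum>k = 2..n. a k * sin (real k * x)))"
    by (simp add: algebra_simps)
  moreover have "0 < sin (x/2)"
    using x by (intro sin_gt_zero) auto
  ultimately show ?thesis
    by (simp add: zero_less_mult_iff)
qed

section \<open>The alternating sine sums near zero\<close>

definition alt_sine_sum :: "nat \<Rightarrow> real \<Rightarrow> real" where
  "alt_sine_sum k y = (\<Sum>j = 1..k. (-1) ^ (j + 1) * sin (real j * y) / real j)"

definition alt_cosine_sum :: "nat \<Rightarrow> real \<Rightarrow> real" where
  "alt_cosine_sum k y = (\<Sum>j = 1..k. (-1) ^ (j + 1) * cos (real j * y))"

lemma alt_sine_sum_deriv: "(alt_sine_sum k has_real_derivative alt_cosine_sum k t) (at t)"
proof -
  have "((\<lambda>y. \<Sum>j = 1..k. (-1) ^ (j + 1) * sin (real j * y) / real j) has_real_derivative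
         (\<Sum>j = 1..k. (-1) ^ (j + 1) * cos (real j * t))) (at t)"
    by (rule DERIV_sum) (auto intro!: derivative_eq_intros)
  then show ?thesis
    by (simp add: alt_sine_sum_def[abs_def] alt_cosine_sum_def)
qed

lemma alt_sine_sum_zero [simp]: "alt_sine_sum k 0 = 0"
  by (simp add: alt_sine_sum_def)

lemma alt_cosine_sum_closed_form:
  "2 * cos (t / 2) * alt_cosine_sum k t = cos (t / 2) - (-1) ^ k * cos ((real k + 1/2) * t)"
proof (induction k)
  case 0
  show ?case by (simp add: alt_cosine_sum_def)
next
  case (Suc k)
  have "2 * cos (t/2) * cos (real (Suc k) * t)
      = cos ((real k + 1/2) * t) + cos ((real (Suc k) + 1/2) * t)"
    using cos_times_cos[of "real (Suc k) * t" "t/2"] by (simp add: field_simps)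
  from arg_cong[OF this, of "\<lambda>u. (-1) ^ k * u"] Suc show ?case
    by (simp add: alt_cosine_sum_def algebra_simps)
qed

lemma sin_lower_bound_cubic:
  fixes y :: real
  assumes "0 \<le> y"
  shows "y - y ^ 3 / 6 \<le> sin y"
proof -
  have "\<bar>sin y - y\<bar> \<le> y ^ 3 / 6"
    using Maclaurin_sin_bound[of y 3] assms
    by (simp add: eval_nat_numeral sin_coeff_def)
  then show ?thesis by linarith
qed

text \<open>
  As long as \<open>(k + 1/2) t \<le> 5/4\<close>, the oscillating term \<open>cos ((k + 1/2) t)\<close> is dominated by both
  \<open>cos (t/2)\<close> and \<open>cos (3t/2)\<close>. The closed form of the derivative then shows that
  \<open>alt_sine_sum k\<close> and \<open>sin - alt_sine_sum k\<close> are both nondecreasing; for the latter,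
  \<open>2 cos t cos (t/2) - cos (t/2) = cos (3t/2)\<close>.
\<close>

lemma alt_sine_sum_bounds_initial:
  fixes y :: real
  assumes "k \<ge> 1" "0 \<le> y" "y \<le> 1/2" and m: "(real k + 1/2) * y \<le> 5/4"
  shows "0 \<le> alt_sine_sum k y" "alt_sine_sum k y \<le> sin y"
proof -
  have key: "0 < cos (t/2) \<and> 0 \<le> alt_cosine_sum k t \<and> alt_cosine_sum k t \<le> cos t"
    if t: "0 \<le> t" "t \<le> y" for t
  proof -
    have pi2: "2 \<le> pi" by (rule pi_ge_two)
    have mt: "(real k + 1/2) * t \<le> 5/4"
      using mult_left_mono[OF t(2), of "real k + 1/2"] m by linarith
    have mt2: "3 * t / 2 \<le> (real k + 1/2) * t"
      using mult_right_mono[of "3/2" "real k + 1/2" t] t \<open>k \<ge> 1\<close> by simp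
    have pos: "0 < cos (t/2)"
      using t \<open>y \<le> 1/2\<close> pi2 by (intro cos_gt_zero_pi) auto
    have up: "cos ((real k + 1/2) * t) \<le> cos (3 * t / 2)"
      using t mt mt2 pi2 by (intro cos_monotone_0_pi_le) auto
    have "cos (pi - 3 * t / 2) \<le> cos ((real k + 1/2) * t)"
      using t mt mt2 pi2 \<open>y \<le> 1/2\<close> by (intro cos_monotone_0_pi_le) auto
    then have lo: "- cos (3 * t / 2) \<le> cos ((real k + 1/2) * t)"
      by (simp add: cos_diff)
    have osc: "\<bar>(-1) ^ k * cos ((real k + 1/2) * t)\<bar> \<le> cos (3 * t / 2)"
      using up lo by (simp add: abs_mult)
    have "cos (3 * t / 2) \<le> cos (t/2)"
      using t \<open>y \<le> 1/2\<close> pi2 by (intro cos_monotone_0_pi_le) auto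
    with osc have "0 \<le> 2 * cos (t/2) * alt_cosine_sum k t"
      unfolding alt_cosine_sum_closed_form by linarith
    then have ge: "0 \<le> alt_cosine_sum k t"
      using pos by (simp add: zero_le_mult_iff)
    have "2 * cos (t/2) * cos t = cos (t/2) + cos (3 * t / 2)"
      using cos_times_cos[of t "t/2"] by (simp add: field_simps)
    then have "2 * cos (t/2) * alt_cosine_sum k t \<le> 2 * cos (t/2) * cos t"
      unfolding alt_cosine_sum_closed_form using osc by linarith
    then have "alt_cosine_sum k t \<le> cos t"
      using pos by simp
    with pos ge show ?thesis by simp
  qed
  have "alt_sine_sum k 0 \<le> alt_sine_sum k y"
    using key alt_sine_sum_deriv by (intro DERIV_nonneg_imp_nondecreasing[OF \<open>0 \<le> y\<close>]) blast
  then show "0 \<le> alt_sine_sum k y" by simp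
  have "sin 0 - alt_sine_sum k 0 \<le> sin y - alt_sine_sum k y"
  proof (rule DERIV_nonneg_imp_nondecreasing[OF \<open>0 \<le> y\<close>])
    fix t assume t: "0 \<le> t" "t \<le> y"
    have "((\<lambda>u. sin u - alt_sine_sum k u) has_real_derivative cos t - alt_cosine_sum k t) (at t)"
      by (intro DERIV_diff DERIV_sin alt_sine_sum_deriv)
    then show "\<exists>z. ((\<lambda>u. sin u - alt_sine_sum k u) has_real_derivative z) (at t) \<and> 0 \<le> z"
      using key[OF t] by (intro exI[of _ "cos t - alt_cosine_sum k t"]) simp
  qed
  then show "alt_sine_sum k y \<le> sin y" by simp
qed

text \<open>
  Integration by parts of the oscillating part of the derivative, phrased with monotone functions.
  Let \<open>m = k + 1/2\<close>. Adding the boundary term \<open>\<plusminus> sin (m t) / (2 m cos (t/2))\<close> to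
  \<open>alt_sine_sum k t - t/2\<close> leaves a function \<open>D\<close> whose derivative is at most that of
  \<open>R t = 1 / (2 m cos (t/2))\<close> in absolute value; the boundary term itself is at most \<open>R\<close>.
\<close>

lemma alt_sine_sum_near_half:
  fixes y :: real
  assumes "0 \<le> y" "y \<le> 1/2"
  shows "\<bar>alt_sine_sum k y - y / 2\<bar> \<le> (2 / cos (y / 2) - 1) / (2 * (real k + 1/2))"
proof -
  define m where "m = real k + 1/2"
  define s :: real where "s = (-1) ^ k"
  define D where "D t = alt_sine_sum k t - t / 2 + s * sin (m * t) / (2 * m * cos (t/2))" for t
  define R where "R t = 1 / (2 * m * cos (t/2))" for t
  define R' where "R' t = sin (t/2) / (4 * m * (cos (t/2))\<^sup>2)" for t
  define D' where "D' t = s * sin (m * t) * R' t" for t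
  have m: "m > 0" by (simp add: m_def)
  have s: "\<bar>s\<bar> = 1" by (simp add: s_def power_abs)
  have pi2: "2 \<le> pi" by (rule pi_ge_two)
  have pos: "0 < cos (t/2)" if "0 \<le> t" "t \<le> y" for t
    using that \<open>y \<le> 1/2\<close> pi2 by (intro cos_gt_zero_pi) auto
  have R_deriv: "(R has_real_derivative R' t) (at t)" if t: "0 \<le> t" "t \<le> y" for t
    unfolding R_def[abs_def] R'_def using pos[OF t] m
    by (auto intro!: derivative_eq_intros simp: field_simps power2_eq_square)
  have D_deriv: "(D has_real_derivative D' t) (at t)" if t: "0 \<le> t" "t \<le> y" for t
  proof -
    have eq: "alt_cosine_sum k t = (cos (t/2) - s * cos (m * t)) / (2 * cos (t/2))"
      using alt_cosine_sum_closed_form[of t k] pos[OF t]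
      by (simp add: s_def m_def field_simps)
    have "D' t = alt_cosine_sum k t - 1/2
        + (s * (cos (m * t) * m) * (2 * m * cos (t/2)) - s * sin (m * t) * (2 * m * (- sin (t/2) * (1/2))))
          / ((2 * m * cos (t/2)) * (2 * m * cos (t/2)))"
      unfolding eq D'_def R'_def using pos[OF t] m
      by (simp add: field_simps power2_eq_square)
    moreover have "(D has_real_derivative alt_cosine_sum k t - 1/2
        + (s * (cos (m * t) * m) * (2 * m * cos (t/2)) - s * sin (m * t) * (2 * m * (- sin (t/2) * (1/2))))
          / ((2 * m * cos (t/2)) * (2 * m * cos (t/2)))) (at t)"
      unfolding D_def[abs_def] using pos[OF t] m
      by (intro DERIV_add DERIV_diff DERIV_divide alt_sine_sum_deriv)
        (auto intro!: derivative_eq_intros)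
    ultimately show ?thesis by simp
  qed
  have D'_le: "\<bar>D' t\<bar> \<le> R' t" if t: "0 \<le> t" "t \<le> y" for t
  proof -
    have "0 \<le> sin (t/2)"
      using t \<open>y \<le> 1/2\<close> pi2 by (intro sin_ge_zero) auto
    then have R'0: "0 \<le> R' t"
      using m by (simp add: R'_def)
    have "\<bar>D' t\<bar> = \<bar>sin (m * t)\<bar> * R' t"
      using R'0 s by (simp add: D'_def abs_mult)
    also have "\<dots> \<le> 1 * R' t"
      using R'0 by (intro mult_right_mono) auto
    finally show ?thesis by simp
  qed
  have "R 0 - D 0 \<le> R y - D y"
  proof (rule DERIV_nonneg_imp_nondecreasing[OF \<open>0 \<le> y\<close>])
    fix t assume t: "0 \<le> t" "t \<le> y"
    show "\<exists>z. ((\<lambda>t. R t - D t) has_real_derivative z) (at t) \<and> 0 \<le> z"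
      using DERIV_diff[OF R_deriv[OF t] D_deriv[OF t]] D'_le[OF t]
      by (intro exI[of _ "R' t - D' t"]) auto
  qed
  moreover have "R 0 + D 0 \<le> R y + D y"
  proof (rule DERIV_nonneg_imp_nondecreasing[OF \<open>0 \<le> y\<close>])
    fix t assume t: "0 \<le> t" "t \<le> y"
    show "\<exists>z. ((\<lambda>t. R t + D t) has_real_derivative z) (at t) \<and> 0 \<le> z"
      using DERIV_add[OF R_deriv[OF t] D_deriv[OF t]] D'_le[OF t]
      by (intro exI[of _ "R' t + D' t"]) auto
  qed
  moreover have "D 0 = 0" "R 0 = 1 / (2 * m)"
    by (simp_all add: D_def R_def)
  ultimately have "\<bar>D y\<bar> \<le> R y - 1 / (2 * m)" by linarith
  moreover have "\<bar>s * sin (m * y) / (2 * m * cos (y/2))\<bar> \<le> R y"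
    using pos[of y] \<open>0 \<le> y\<close> m s by (simp add: R_def abs_mult divide_right_mono)
  ultimately have "\<bar>alt_sine_sum k y - y / 2\<bar> \<le> 2 * R y - 1 / (2 * m)"
    unfolding D_def by linarith
  also have "2 * R y - 1 / (2 * m) = (2 / cos (y/2) - 1) / (2 * m)"
    using pos[of y] \<open>0 \<le> y\<close> m by (simp add: R_def field_simps)
  finally show ?thesis by (simp only: m_def)
qed

text \<open>
  For \<open>(k + 1/2) y > 5/4\<close> the deviation from \<open>y/2\<close> is at most \<open>33/62 \<sqdot> 4/5 \<sqdot> y\<close>, which is at most
  \<open>11/24 \<sqdot> y\<close>, hence at most \<open>y/2\<close> and, by the cubic bound for the sine, at most \<open>sin y - y/2\<close>. The number \<open>33/62\<close> comes from
  \<open>cos (y/2) \<ge> 1 - y\<^sup>2/8 \<ge> 31/32\<close>.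
\<close>

lemma alt_sine_sum_bounds:
  fixes y :: real
  assumes "k \<ge> 1" "0 \<le> y" "y \<le> 1/2"
  shows "0 \<le> alt_sine_sum k y" "alt_sine_sum k y \<le> sin y"
proof -
  have "0 \<le> alt_sine_sum k y \<and> alt_sine_sum k y \<le> sin y"
  proof (cases "(real k + 1/2) * y \<le> 5/4")
    case True
    then show ?thesis
      using alt_sine_sum_bounds_initial[OF assms] by simp
  next
    case False
    have y2: "y\<^sup>2 \<le> 1/4"
      using power_mono[OF \<open>y \<le> 1/2\<close> \<open>0 \<le> y\<close>, of 2] by (simp add: power2_eq_square)
    have "(sin (y/4))\<^sup>2 \<le> (y/4)\<^sup>2"
      using assms sin_x_le_x[of "y/4"] pi_ge_two by (intro power_mono sin_ge_zero) auto
    then have "31/32 \<le> cos (y/2)"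
      using cos_double_sin[of "y/4"] y2 by (simp add: power_divide)
    then have "2 / cos (y/2) \<le> 2 / (31/32)"
      by (intro divide_left_mono) auto
    then have "(2 / cos (y/2) - 1) / (2 * (real k + 1/2)) \<le> (33/31) / (2 * (real k + 1/2))"
      by (intro divide_right_mono) auto
    also have "\<dots> \<le> 33/62 * (4/5) * y"
      using False by (simp add: field_simps)
    finally have dev: "\<bar>alt_sine_sum k y - y / 2\<bar> \<le> 33/62 * (4/5) * y"
      using alt_sine_sum_near_half[of y k] assms by linarith
    have "y ^ 3 \<le> 1/4 * y"
      using mult_right_mono[OF y2 \<open>0 \<le> y\<close>] by (simp add: power2_eq_square power3_eq_cube)
    then have "23/24 * y \<le> sin y"
      using sin_lower_bound_cubic[OF \<open>0 \<le> y\<close>] by linarith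
    with dev \<open>0 \<le> y\<close> show ?thesis by linarith
  qed
  then show "0 \<le> alt_sine_sum k y" "alt_sine_sum k y \<le> sin y" by simp_all
qed

section \<open>Unimodal weights near the endpoint\<close>

text \<open>
  Let \<open>C n\<close> be the partial sums of \<open>s\<close>, which lie in \<open>[- A, 0]\<close>. While \<open>b\<close> increases, summation by
  parts has only favourable terms and the weighted sum is at least \<open>b n \<sqdot> C n\<close>. From the maximum
  \<open>M\<close> of \<open>b\<close> on, each decrease \<open>b n - b (n + 1)\<close> costs at most that multiple of \<open>A\<close>, so the total
  cost of the decreasing phase is at most \<open>(M - b n) A\<close>.
\<close>

lemma unimodal_weighted_sum_bound:
  fixes b s :: "nat \<Rightarrow> real"
  assumes b: "\<And>k. k \<ge> 2 \<Longrightarrow> 0 \<le> b k" "\<And>k. k \<ge> 2 \<Longrightarrow> b k < 1"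
    and unimodal: "\<And>k. k \<ge> 2 \<Longrightarrow> b (Suc k) \<le> b k \<Longrightarrow> b (Suc (Suc k)) \<le> b (Suc k)"
    and A: "0 < A"
    and C: "\<And>n. n \<ge> 2 \<Longrightarrow> - A \<le> (\<Sum>k = 2..n. s k)" "\<And>n. n \<ge> 2 \<Longrightarrow> (\<Sum>k = 2..n. s k) \<le> 0"
    and n: "n \<ge> 2"
  shows "- A < (\<Sum>k = 2..n. b k * s k)"
proof -
  define C where "C n = (\<Sum>k = 2..n. s k)" for n
  define T where "T n = (\<Sum>k = 2..n. b k * s k)" for n
  have C_bounds: "- A \<le> C n" "C n \<le> 0" if "n \<ge> 2" for n
    using that assms(5,6) by (auto simp: C_def)
  \<comment> \<open>the two alternatives are the increasing and the decreasing phase\<close>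
  have "b n * C n \<le> T n \<or>
        (\<exists>M<1. b (Suc n) \<le> b n \<and> b n * C n - (M - b n) * A \<le> T n)"
    using n
  proof (induction n rule: dec_induct)
    case base
    show ?case by (simp add: C_def T_def)
  next
    case (step n)
    have C_Suc: "C (Suc n) = C n + s (Suc n)" and T_Suc: "T (Suc n) = T n + b (Suc n) * s (Suc n)"
      using step.hyps by (simp_all add: C_def T_def)
    then have T_eq: "T (Suc n) = T n - b n * C n + b (Suc n) * C (Suc n) + (b n - b (Suc n)) * C n"
      by (simp add: algebra_simps)
    show ?case
    proof (cases "b (Suc n) \<le> b n")
      case True
      have loss: "(b n - b (Suc n)) * (- A) \<le> (b n - b (Suc n)) * C n"
        using C_bounds(1)[of n] True step.hyps by (intro mult_left_mono) auto
      from step.IH obtain M where M: "M < 1" "b n * C n - (M - b n) * A \<le> T n"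
      proof
        assume "b n * C n \<le> T n"
        then show thesis using that[of "b n"] b(2)[of n] step.hyps by simp
      qed (use that in blast)
      have "b (Suc n) * C (Suc n) - (M - b (Suc n)) * A \<le> T (Suc n)"
        using T_eq loss M(2) by (simp add: algebra_simps)
      then show ?thesis
        using M(1) unimodal[of n] True step.hyps by auto
    next
      case False
      then have "b n * C n \<le> T n" using step.IH by auto
      moreover have "0 \<le> (b n - b (Suc n)) * C n"
        using False C_bounds(2)[of n] step.hyps by (simp add: mult_nonpos_nonpos)
      ultimately show ?thesis using T_eq by simp
    qed
  qed
  then obtain M where M: "M < 1" "b n * C n - (M - b n) * A \<le> T n"
  proof
    assume "b n * C n \<le> T n"
    then show thesis using that[of "b n"] b(2)[OF n] by simp
  qed (use that in blast)
  have "b n * (- A) \<le> b n * C n"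
    using C_bounds(1)[OF n] b(1)[OF n] by (intro mult_left_mono)
  with M(2) have "- (M * A) \<le> T n"
    by (simp add: algebra_simps)
  moreover have "M * A < A"
    using M(1) A by simp
  ultimately show ?thesis
    unfolding T_def by linarith
qed

lemma sine_sum_pos_near_pi:
  fixes a :: "nat \<Rightarrow> real" and x :: real
  assumes b: "\<And>k. k \<ge> 2 \<Longrightarrow> 0 \<le> real k * a k" "\<And>k. k \<ge> 2 \<Longrightarrow> real k * a k < 1"
    and unimodal: "\<And>k. k \<ge> 2 \<Longrightarrow> real (Suc k) * a (Suc k) \<le> real k * a k
          \<Longrightarrow> real (Suc (Suc k)) * a (Suc (Suc k)) \<le> real (Suc k) * a (Suc k)"
    and n: "n \<ge> 2" and x: "pi - 1/2 \<le> x" "x < pi"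
  shows "0 < sin x + (\<Sum>k = 2..n. a k * sin (real k * x))"
proof -
  define y where "y = pi - x"
  define s where "s k = (-1) ^ (k + 1) * sin (real k * y) / real k" for k
  have y: "0 < y" "y \<le> 1/2" using x by (auto simp: y_def)
  have sin_y: "0 < sin y"
    using y pi_ge_two by (intro sin_gt_zero) auto
  have C: "(\<Sum>k = 2..m. s k) = alt_sine_sum m y - sin y" if "m \<ge> 2" for m
  proof -
    have "alt_sine_sum m y = s 1 + (\<Sum>k = 2..m. s k)"
      unfolding alt_sine_sum_def s_def using that
      by (subst sum.atLeast_Suc_atMost) (auto simp: numeral_2_eq_2)
    then show ?thesis by (simp add: s_def)
  qed
  have "- sin y < (\<Sum>k = 2..n. real k * a k * s k)"
  proof (rule unimodal_weighted_sum_bound[where b = "\<lambda>k. real k * a k"])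
    fix m :: nat assume "m \<ge> 2"
    then show "- sin y \<le> (\<Sum>k = 2..m. s k)" "(\<Sum>k = 2..m. s k) \<le> 0"
      using alt_sine_sum_bounds[of m y] y by (simp_all add: C)
  qed (use b unimodal sin_y n in auto)
  also have "(\<Sum>k = 2..n. real k * a k * s k) = (\<Sum>k = 2..n. a k * sin (real k * x))"
  proof (intro sum.cong refl)
    fix k assume "k \<in> {2..n}"
    have "sin (real k * x) = sin (real k * pi - real k * y)"
      by (simp add: y_def algebra_simps)
    also have "\<dots> = (-1) ^ (k + 1) * sin (real k * y)"
      by (simp add: sin_diff mult.commute[of _ pi])
    finally show "real k * a k * s k = a k * sin (real k * x)"
      using \<open>k \<in> {2..n}\<close> by (simp add: s_def)
  qed
  finally show ?thesis by (simp add: y_def sin_diff)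
qed

section \<open>The weights\<close>

locale weight_parameters =
  fixes \<alpha> \<beta> l \<mu> :: real
  assumes \<alpha>_pos: "\<alpha> > 0" and l_pos: "l > 0" and \<alpha>_less_\<beta>: "\<alpha> < \<beta>"
    and \<mu>_ge: "\<mu> \<ge> 1 + l" and cross: "l * \<beta> - \<alpha> * \<mu> < 0"
begin

definition w :: "real \<Rightarrow> real" where
  "w t = (t + \<alpha>) powr l / (t + \<beta>) powr \<mu>"

definition ln_w :: "real \<Rightarrow> real" where
  "ln_w t = l * ln (t + \<alpha>) - \<mu> * ln (t + \<beta>)"

lemma w_eq_exp: "t \<ge> 0 \<Longrightarrow> w t = exp (ln_w t)"
  using \<alpha>_pos \<alpha>_less_\<beta> by (simp add: w_def ln_w_def powr_def exp_diff)

lemma w_pos: "t \<ge> 0 \<Longrightarrow> 0 < w t"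
  by (simp add: w_eq_exp)

lemma ln_w_deriv:
  "t \<ge> 0 \<Longrightarrow> (ln_w has_real_derivative l / (t + \<alpha>) - \<mu> / (t + \<beta>)) (at t)"
  unfolding ln_w_def[abs_def] using \<alpha>_pos \<alpha>_less_\<beta>
  by (auto intro!: derivative_eq_intros)

lemma w_antimono:
  assumes "0 \<le> s" "s \<le> t"
  shows "w t \<le> w s"
proof -
  have "ln_w t \<le> ln_w s"
  proof (rule DERIV_nonpos_imp_nonincreasing[OF \<open>s \<le> t\<close>])
    fix u assume "s \<le> u" "u \<le> t"
    with assms have u: "u \<ge> 0" by simp
    have "(l - \<mu>) * u \<le> 0"
      using \<mu>_ge u by (simp add: mult_nonpos_nonneg)
    then have "l * (u + \<beta>) \<le> \<mu> * (u + \<alpha>)"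
      using cross by (simp add: algebra_simps)
    then have "l / (u + \<alpha>) \<le> \<mu> / (u + \<beta>)"
      using u \<alpha>_pos \<alpha>_less_\<beta> by (simp add: field_simps)
    then have "l / (u + \<alpha>) - \<mu> / (u + \<beta>) \<le> 0" by simp
    with ln_w_deriv[OF u] show "\<exists>z. (ln_w has_real_derivative z) (at u) \<and> z \<le> 0" by blast
  qed
  then show ?thesis
    using assms by (simp add: w_eq_exp)
qed

text \<open>
  Since \<open>t + \<beta> \<ge> 1\<close>, lowering the exponent \<open>\<mu>\<close> to \<open>1 + l\<close> can only increase the weight; for
  \<open>\<mu> = 1 + l\<close> the product is \<open>t / (t + \<beta>)\<close> times a power of \<open>(t + \<alpha>) / (t + \<beta>)\<close>.
\<close>

lemma t_w_less_one:
  assumes "t \<ge> 1"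
  shows "t * w t < 1"
proof -
  have "t * (t + \<alpha>) powr l < (t + \<beta>) * (t + \<beta>) powr l"
    using assms \<alpha>_pos \<alpha>_less_\<beta> l_pos
    by (intro mult_strict_mono powr_less_mono2) auto
  also have "\<dots> = (t + \<beta>) powr (1 + l)"
    using assms \<alpha>_pos \<alpha>_less_\<beta> by (simp add: powr_add)
  also have "\<dots> \<le> (t + \<beta>) powr \<mu>"
    using assms \<alpha>_pos \<alpha>_less_\<beta> \<mu>_ge by (intro powr_mono) auto
  finally show ?thesis
    using assms \<alpha>_pos \<alpha>_less_\<beta> by (simp add: w_def)
qed

text \<open>The numerator of the logarithmic derivative of \<open>t w t\<close>, a quadratic polynomial.\<close>

definition q :: "real \<Rightarrow> real" where
  "q t = (t + \<alpha>) * (t + \<beta>) + l * t * (t + \<beta>) - \<mu> * t * (t + \<alpha>)"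

lemma ln_t_w_deriv:
  assumes "t > 0"
  shows "((\<lambda>t. ln t + ln_w t) has_real_derivative q t / (t * (t + \<alpha>) * (t + \<beta>))) (at t)"
proof -
  have nz: "t \<noteq> 0" "t + \<alpha> \<noteq> 0" "t + \<beta> \<noteq> 0"
    using assms \<alpha>_pos \<alpha>_less_\<beta> by auto
  have "1 / t + (l / (t + \<alpha>) - \<mu> / (t + \<beta>)) = q t / (t * (t + \<alpha>) * (t + \<beta>))"
    using nz by (simp add: q_def divide_simps) (simp add: algebra_simps)
  moreover have "((\<lambda>t. ln t + ln_w t) has_real_derivative
      1 / t + (l / (t + \<alpha>) - \<mu> / (t + \<beta>))) (at t)"
    using assms ln_w_deriv[of t] by (intro DERIV_add DERIV_ln_divide) auto
  ultimately show ?thesis by simp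
qed

text \<open>
  The leading coefficient of \<open>q\<close> is \<open>1 + l - \<mu> \<le> 0\<close> and its constant term is \<open>\<alpha> \<beta> > 0\<close>, so
  \<open>q t / t\<close> is decreasing for \<open>t > 0\<close>.
\<close>

lemma q_stays_nonpos:
  assumes "0 < s" "s \<le> t" "q s \<le> 0"
  shows "q t \<le> 0"
proof -
  have "0 \<le> (\<mu> - 1 - l) * (s * t) + \<alpha> * \<beta>"
    using assms \<mu>_ge \<alpha>_pos \<alpha>_less_\<beta> by (intro add_nonneg_nonneg mult_nonneg_nonneg) auto
  then have "0 \<le> (t - s) * ((\<mu> - 1 - l) * (s * t) + \<alpha> * \<beta>)"
    using assms by simp
  also have "\<dots> = q s * t - q t * s"
    by (simp add: q_def algebra_simps)
  finally have "q t * s \<le> q s * t" by simp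
  also have "\<dots> \<le> 0"
    using assms by (simp add: mult_nonpos_nonneg)
  finally show ?thesis
    using assms by (simp add: mult_le_0_iff)
qed

text \<open>
  If \<open>t w t\<close> does not increase strictly from \<open>r\<close> to \<open>s\<close>, then \<open>q\<close> is nonpositive somewhere in
  between, hence everywhere after \<open>s\<close>, and \<open>t w t\<close> is nonincreasing there.
\<close>

lemma t_w_unimodal:
  assumes "0 < r" "r < s" "s \<le> t" and le: "s * w s \<le> r * w r"
  shows "t * w t \<le> s * w s"
proof -
  have eq: "u * w u = exp (ln u + ln_w u)" if "u > 0" for u
    using that by (simp add: w_eq_exp exp_add)
  have den: "0 < u * (u + \<alpha>) * (u + \<beta>)" if "u > 0" for u
    using that \<alpha>_pos \<alpha>_less_\<beta> by simp
  obtain u where u: "r \<le> u" "u \<le> s" "q u \<le> 0"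
  proof (rule ccontr)
    assume "\<not> thesis"
    then have qpos: "0 < q u" if "r \<le> u" "u \<le> s" for u
      using \<open>\<And>u. r \<le> u \<Longrightarrow> u \<le> s \<Longrightarrow> q u \<le> 0 \<Longrightarrow> thesis\<close> that by force
    have "ln r + ln_w r < ln s + ln_w s"
    proof (rule DERIV_pos_imp_increasing[OF \<open>r < s\<close>])
      fix u assume u: "r \<le> u" "u \<le> s"
      then have "u > 0" using \<open>0 < r\<close> by simp
      then show "\<exists>z. ((\<lambda>t. ln t + ln_w t) has_real_derivative z) (at u) \<and> 0 < z"
        using ln_t_w_deriv[of u] qpos[OF u] den[of u] by (meson divide_pos_pos)
    qed
    with le show False
      using assms by (simp add: eq)
  qed
  have "ln t + ln_w t \<le> ln s + ln_w s"
  proof (rule DERIV_nonpos_imp_nonincreasing[OF \<open>s \<le> t\<close>])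
    fix v assume v: "s \<le> v" "v \<le> t"
    then have "v > 0" "q v \<le> 0"
      using q_stays_nonpos[of u v] u assms by auto
    then show "\<exists>z. ((\<lambda>t. ln t + ln_w t) has_real_derivative z) (at v) \<and> z \<le> 0"
      using ln_t_w_deriv[of v] den[of v] by (meson divide_nonpos_pos)
  qed
  then show ?thesis
    using assms by (simp add: eq)
qed

end

section \<open>Positivity of the sine sums\<close>

theorem theorem3p1:
  fixes \<alpha> \<beta> l \<mu> x :: real and n :: nat
  assumes "\<alpha> > 0" and "\<beta> > 0" and "l > 0" and "\<mu> > 0"
    and "\<alpha> < \<beta>" and "\<mu> \<ge> 1 + l" and "l * \<beta> - \<alpha> * \<mu> < 0"
    and "n \<ge> 1"
    and "x \<in> {0<..<pi}"
  shows "sin x + (\<Sum>k = 2..n. (real k + \<alpha>) powr l / (real k + \<beta>) powr \<mu> * sin (real k * x)) > 0"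
proof -
  interpret weight_parameters \<alpha> \<beta> l \<mu>
    using assms by unfold_locales auto
  have x: "0 < x" "x < pi" using assms by auto
  have "0 < sin x + (\<Sum>k = 2..n. w (real k) * sin (real k * x))"
  proof (cases "n \<ge> 2")
    case False
    then show ?thesis
      using sin_gt_zero[OF x] by simp
  next
    case n: True
    show ?thesis
    proof (cases "pi - 1/2 \<le> x")
      case True
      show ?thesis
      proof (rule sine_sum_pos_near_pi[OF _ _ _ n True x(2)])
        fix k :: nat assume k: "k \<ge> 2"
        show "0 \<le> real k * w (real k)"
          using w_pos[of "real k"] by simp
        show "real k * w (real k) < 1"
          using k by (intro t_w_less_one) simp
        show "real (Suc (Suc k)) * w (real (Suc (Suc k))) \<le> real (Suc k) * w (real (Suc k))"
          if "real (Suc k) * w (real (Suc k)) \<le> real k * w (real k)"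
          by (rule t_w_unimodal[OF _ _ _ that]) (use k in simp_all)
      qed
    next
      case False
      \<comment> \<open>\<open>1/4\<close> is half the distance from \<open>\<pi>\<close> at which the interval is cut, and \<open>cos (x/2) = sin ((\<pi> - x)/2)\<close>\<close>
      have "21/100 \<le> (1/4 :: real) - (1/4) ^ 3 / 6" by (simp add: power3_eq_cube)
      also have "\<dots> \<le> sin (1/4)" by (rule sin_lower_bound_cubic) simp
      also have "\<dots> \<le> sin (pi/2 - x/2)"
        using False x by (intro sin_monotone_2pi_le) auto
      also have "\<dots> = cos (x/2)" by (simp add: sin_diff)
      finally have c: "21/100 \<le> cos (x/2)" .
      have a2: "w (real 2) \<le> 1/2"
        using t_w_less_one[of 2] by simp
      show ?thesis
        by (rule sine_sum_pos_away_from_pi[of "\<lambda>k. w (real k)", OF _ _ a2 n x c])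
          (auto intro: w_antimono less_imp_le[OF w_pos])
    qed
  qed
  then show ?thesis by (simp add: w_def)
qed

end
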